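(* Let $H\in\mathbb{C}^{N\times N}$ be Hermitian negative definite with eigenvalues $\lambda_1\le\dots\le\lambda_N<0$ and suppose $\lambda_m<\lambda_{m+1}$. Let $\alpha\in(0,1)$. Then there exists $\mu_0(\alpha)>0$ such that for all $0<\mu<\mu_0(\alpha)$ and all $X_\mu\in S_\mu$, $$\|X_\mu^*X_\mu-I\|_F\le\frac{2\mu m\sqrt{N}}{\alpha^2(\lambda_{m+1}-\lambda_m)}.$$
   Context: $N,m$ are positive integers with $m<N$ (so that $\lambda_{m+1}$ makes sense), and eigenvalues are listed with multiplicity. For $X\in\mathbb{C}^{N\times m}$, $E_0(X)=\operatorname{tr}\bigl[(2I-X^*X)X^*HX\bigr]$, where $X^*$ is the conjugate transpose, and for $\mu\ge0$, $E_\mu(X)=E_0(X)+\mu\sum_{i,j}|X_{ij}|$. The set $S_\mu$ is the set of all global minimizers of $E_\mu$ over $\mathbb{C}^{N\times m}$. $\|\cdot\|_F$ is the Frobenius norm and $I$ the $m\times m$ identity. The threshold $\mu_0(\alpha)$ may depend on $H$, $N$, $m$ and $\alpha$. *)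

theory Defs
  imports "Jordan_Normal_Form.Schur_Decomposition"
begin

text \<open>Matrices and vectors have complex entries; \<^const>\<open>mat_adjoint\<close> is the conjugate transpose and
  \<open>v \<bullet>c w\<close> is \<open>\<Sum>i. v\<^sub>i * cnj w\<^sub>i\<close>.\<close>

lemma index_mat_adjoint:
  fixes A :: "complex mat"
  assumes "i < dim_col A" "j < dim_row A"
  shows "mat_adjoint A $$ (i, j) = cnj (A $$ (j, i))"
  using assms by (simp add: mat_adjoint_def mat_of_rows_def conjugate_vec_def)

lemma dim_mat_adjoint [simp]:
  "dim_row (mat_adjoint A) = dim_col A" "dim_col (mat_adjoint A) = dim_row A"
  by (simp_all add: mat_adjoint_def)

definition mat_trace :: "complex mat \<Rightarrow> complex"
  where "mat_trace A = (\<Sum>i<dim_row A. A $$ (i, i))"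

definition frobenius_norm :: "complex mat \<Rightarrow> real"
  where "frobenius_norm A = sqrt (\<Sum>i<dim_row A. \<Sum>j<dim_col A. (cmod (A $$ (i, j)))\<^sup>2)"

definition hermitian_mat :: "complex mat \<Rightarrow> bool"
  where "hermitian_mat A \<longleftrightarrow> mat_adjoint A = A"

definition negative_definite_mat :: "nat \<Rightarrow> complex mat \<Rightarrow> bool"
  where "negative_definite_mat n A \<longleftrightarrow>
    (\<forall>v \<in> carrier_vec n. v \<noteq> 0\<^sub>v n \<longrightarrow> Re ((A *\<^sub>v v) \<bullet>c v) < 0)"

text \<open>\<open>l 1 \<le> \<dots> \<le> l n\<close> are the eigenvalues of \<open>A\<close>, repeated according to their multiplicity as roots
  of the characteristic polynomial. Values of \<open>l\<close> outside \<open>{1..n}\<close> are irrelevant.\<close>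

definition ordered_eigenvalues :: "nat \<Rightarrow> complex mat \<Rightarrow> (nat \<Rightarrow> real) \<Rightarrow> bool"
  where "ordered_eigenvalues n A l \<longleftrightarrow>
    char_poly A = (\<Prod>k = 1..n. [: - complex_of_real (l k), 1 :]) \<and> mono_on {1..n} l"

text \<open>The trace below is real for Hermitian \<open>H\<close> (see \<open>mat_trace_energy_real\<close>), so taking the real
  part only changes the type.\<close>

definition energy0 :: "complex mat \<Rightarrow> complex mat \<Rightarrow> real"
  where "energy0 H X =
    Re (mat_trace ((2 \<cdot>\<^sub>m 1\<^sub>m (dim_col X) - mat_adjoint X * X) * (mat_adjoint X * H * X)))"

definition energy :: "complex mat \<Rightarrow> real \<Rightarrow> complex mat \<Rightarrow> real"
  where "energy H \<mu> X =
    energy0 H X + \<mu> * (\<Sum>i<dim_row X. \<Sum>j<dim_col X. cmod (X $$ (i, j)))"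

definition minimizers :: "nat \<Rightarrow> nat \<Rightarrow> complex mat \<Rightarrow> real \<Rightarrow> complex mat set"
  where "minimizers N m H \<mu> =
    {X \<in> carrier_mat N m. \<forall>Y \<in> carrier_mat N m. energy H \<mu> X \<le> energy H \<mu> Y}"

lemma mat_trace_mult_hermitian_real:
  assumes A: "A \<in> carrier_mat n n" and B: "B \<in> carrier_mat n n"
    and hA: "\<And>i j. i < n \<Longrightarrow> j < n \<Longrightarrow> A $$ (i, j) = cnj (A $$ (j, i))"
    and hB: "\<And>i j. i < n \<Longrightarrow> j < n \<Longrightarrow> B $$ (i, j) = cnj (B $$ (j, i))"
  shows "mat_trace (A * B) \<in> \<real>"
proof -
  have tr: "mat_trace (A * B) = (\<Sum>i<n. \<Sum>j<n. A $$ (i, j) * B $$ (j, i))"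
    using A B by (auto simp: mat_trace_def scalar_prod_def atLeast0LessThan intro!: sum.cong)
  have "cnj (mat_trace (A * B)) = (\<Sum>i<n. \<Sum>j<n. A $$ (j, i) * B $$ (i, j))"
    unfolding tr by (auto simp: hA[symmetric] hB[symmetric] intro!: sum.cong)
  also have "\<dots> = mat_trace (A * B)"
    unfolding tr by (rule sum.swap)
  finally show ?thesis by (simp add: Reals_cnj_iff)
qed

lemma mat_trace_energy_real:
  assumes H: "H \<in> carrier_mat N N" "hermitian_mat H" and X: "X \<in> carrier_mat N m"
  shows "mat_trace ((2 \<cdot>\<^sub>m 1\<^sub>m m - mat_adjoint X * X) * (mat_adjoint X * H * X)) \<in> \<real>"
proof (rule mat_trace_mult_hermitian_real[where n = m])
  have aX: "mat_adjoint X \<in> carrier_mat m N"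
    using X by (intro carrier_matI) simp_all
  show "2 \<cdot>\<^sub>m 1\<^sub>m m - mat_adjoint X * X \<in> carrier_mat m m"
    by (rule minus_carrier_mat, rule mult_carrier_mat[OF aX X])
  show "mat_adjoint X * H * X \<in> carrier_mat m m"
    by (rule mult_carrier_mat[OF mult_carrier_mat[OF aX H(1)] X])
  have ent: "mat_adjoint X $$ (i, j) = cnj (X $$ (j, i))" if "i < m" "j < N" for i j
    using that X by (intro index_mat_adjoint) auto
  have hH: "H $$ (i, j) = cnj (H $$ (j, i))" if "i < N" "j < N" for i j
    using index_mat_adjoint[of i H j] that H by (auto simp: hermitian_mat_def)
  have dims: "dim_row X = N" "dim_col X = m" "dim_row H = N" "dim_col H = N"
    using X H by auto
  fix i j assume ij: "i < m" "j < m"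
  have G: "(mat_adjoint X * X) $$ (i, j) = (\<Sum>k<N. cnj (X $$ (k, i)) * X $$ (k, j))"
    if "i < m" "j < m" for i j
    using that X aX by (auto simp: scalar_prod_def atLeast0LessThan ent intro!: sum.cong)
  have K: "(mat_adjoint X * H * X) $$ (i, j) =
      (\<Sum>k<N. \<Sum>l<N. cnj (X $$ (l, i)) * H $$ (l, k) * X $$ (k, j))"
    if "i < m" "j < m" for i j
  proof -
    have "(mat_adjoint X * H * X) $$ (i, j) = (\<Sum>k<N. (mat_adjoint X * H) $$ (i, k) * X $$ (k, j))"
      using that dims by (simp add: scalar_prod_def atLeast0LessThan)
    also have "\<dots> = (\<Sum>k<N. (\<Sum>l<N. cnj (X $$ (l, i)) * H $$ (l, k)) * X $$ (k, j))"
      using that dims by (simp add: scalar_prod_def atLeast0LessThan ent)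
    finally show ?thesis by (simp add: sum_distrib_right)
  qed
  show "(2 \<cdot>\<^sub>m 1\<^sub>m m - mat_adjoint X * X) $$ (i, j) =
      cnj ((2 \<cdot>\<^sub>m 1\<^sub>m m - mat_adjoint X * X) $$ (j, i))"
    using ij dims by (simp add: G mult.commute del: index_mult_mat(1))
  have "cnj ((mat_adjoint X * H * X) $$ (j, i)) =
      (\<Sum>k<N. \<Sum>l<N. cnj (X $$ (k, i)) * H $$ (k, l) * X $$ (l, j))"
    unfolding K[OF ij(2,1)] by (simp add: hH[symmetric] mult_ac)
  also have "\<dots> = (mat_adjoint X * H * X) $$ (i, j)"
    unfolding K[OF ij] by (rule sum.swap)
  finally show "(mat_adjoint X * H * X) $$ (i, j) = cnj ((mat_adjoint X * H * X) $$ (j, i))" ..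
qed

end

theory Submission
  imports Defs "HOL-Analysis.L2_Norm"
begin

text \<open>Diagonalizing \<open>H\<close> and \<open>X\<^sup>*X\<close> by unitaries \<open>U\<close>, \<open>V\<close> gives \<open>X = U C V\<^sup>*\<close>, where the columns of
  \<open>C\<close> are orthogonal with squared norms \<open>d\<^sub>i\<close>, and \<open>E\<^sub>0(X) = \<Sum>\<^sub>i (2 - d\<^sub>i) h\<^sub>i\<close> with
  \<open>h\<^sub>i = \<Sum>\<^sub>k \<lambda>\<^sub>k |C\<^sub>k\<^sub>i|\<^sup>2\<close>. Comparing a minimizer with the orthonormal lowest eigenvectors and using Ky
  Fan's inequality, one gets \<open>(2 - d\<^sub>i) h\<^sub>i \<le> \<lambda>\<^sub>m + \<mu> m \<surd>N\<close> for every \<open>i\<close>. For small \<open>\<mu>\<close> this forces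
  \<open>d\<^sub>i > 0\<close> and Rayleigh quotients \<open>h\<^sub>i / d\<^sub>i \<le> - gap / 2\<close>. Next compare \<open>X\<close> with its polar factor
  \<open>Y = X (X\<^sup>*X)\<^sup>-\<^sup>1\<^sup>/\<^sup>2\<close>: the energy \<open>E\<^sub>0\<close> drops by \<open>- \<Sum>\<^sub>i (d\<^sub>i - 1)\<^sup>2 h\<^sub>i / d\<^sub>i\<close>, at least \<open>gap / 2\<close> times
  \<open>\<parallel>X\<^sup>*X - I\<parallel>\<^sup>2\<close>, while the entrywise norm grows by at most
  \<open>\<surd>(N m) \<parallel>Y - X\<parallel> \<le> \<surd>(N m) \<parallel>X\<^sup>*X - I\<parallel>\<close>.\<close>

section \<open>Unitary diagonalization of Hermitian matrices\<close>

lemma mat_adjoint_carrier [simp]: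
  fixes A :: "complex mat"
  shows "A \<in> carrier_mat n k \<Longrightarrow> mat_adjoint A \<in> carrier_mat k n"
  by (intro carrier_matI) auto

lemma index_mult_mat_sum:
  fixes A B :: "complex mat"
  assumes "A \<in> carrier_mat a n" "B \<in> carrier_mat n b" "i < a" "j < b"
  shows "(A * B) $$ (i, j) = (\<Sum>k<n. A $$ (i, k) * B $$ (k, j))"
  using assms by (simp add: scalar_prod_def atLeast0LessThan)

lemma index_adjoint_mult:
  fixes A B :: "complex mat"
  assumes "A \<in> carrier_mat n a" "B \<in> carrier_mat n b" "i < a" "j < b"
  shows "(mat_adjoint A * B) $$ (i, j) = (\<Sum>k<n. cnj (A $$ (k, i)) * B $$ (k, j))"
  using assms
  by (simp add: index_mult_mat_sum[of _ a n _ b] index_mat_adjoint del: index_mult_mat(1))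

lemma mat_adjoint_mult:
  fixes A B :: "complex mat"
  assumes "A \<in> carrier_mat a n" "B \<in> carrier_mat n b"
  shows "mat_adjoint (A * B) = mat_adjoint B * mat_adjoint A"
proof (rule eq_matI)
  fix i j assume "i < dim_row (mat_adjoint B * mat_adjoint A)"
    "j < dim_col (mat_adjoint B * mat_adjoint A)"
  then have ij: "i < b" "j < a" using assms by auto
  show "mat_adjoint (A * B) $$ (i, j) = (mat_adjoint B * mat_adjoint A) $$ (i, j)"
    using ij assms
    by (simp add: index_mat_adjoint index_mult_mat_sum[of _ a n _ b] index_mult_mat_sum[of _ b n _ a]
        mult.commute del: index_mult_mat(1))
qed (use assms in auto)

lemma mat_adjoint_adjoint [simp]:
  fixes A :: "complex mat"
  shows "mat_adjoint (mat_adjoint A) = A"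
  by (rule eq_matI) (auto simp: index_mat_adjoint)

lemma mat_adjoint_one [simp]: "mat_adjoint (1\<^sub>m n :: complex mat) = 1\<^sub>m n"
  by (rule eq_matI) (auto simp: index_mat_adjoint)

lemma mat_adjoint_four_block:
  fixes A :: "complex mat"
  assumes "A \<in> carrier_mat n1 m1" "D \<in> carrier_mat n2 m2"
  shows "mat_adjoint (four_block_mat A (0\<^sub>m n1 m2) (0\<^sub>m n2 m1) D)
    = four_block_mat (mat_adjoint A) (0\<^sub>m m1 n2) (0\<^sub>m m2 n1) (mat_adjoint D)"
  using assms by (intro eq_matI) (auto simp: index_mat_adjoint)

lemma unitary_adjoint:
  fixes U :: "complex mat"
  assumes "U \<in> carrier_mat n n" "mat_adjoint U * U = 1\<^sub>m n"
  shows "U * mat_adjoint U = 1\<^sub>m n"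
  using mat_mult_left_right_inverse[of "mat_adjoint U" n U] assms by simp

text \<open>Gram-Schmidt applied to a basis that starts with \<open>v\<close> keeps \<open>v\<close>
  in front, and dividing each vector by its length makes the columns orthonormal. The construction
  gives for \<open>c\<close> the reciprocal of the length of \<open>v\<close>.\<close>

lemma exists_unitary_first_col:
  fixes v :: "complex vec"
  assumes v: "v \<in> carrier_vec n" "v \<noteq> 0\<^sub>v n"
  obtains W c where "W \<in> carrier_mat n n" "mat_adjoint W * W = 1\<^sub>m n" "col W 0 = c \<cdot>\<^sub>v v"
proof -
  interpret cof_vec_space n "TYPE(complex)" .
  define b where "b = basis_completion v"
  define ws where "ws = gram_schmidt n b"
  have n: "n > 0" using v by (cases n) auto
  from basis_completion[OF v, folded b_def]
  have dist_b: "distinct b" and indep: "\<not> lin_dep (set b)" and b: "set b \<subseteq> carrier_vec n"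
    and hdb: "hd b = v" and len_b: "length b = n" by auto
  from hdb len_b n obtain vs where bv: "b = v # vs" by (cases b) auto
  from gram_schmidt_result[OF b dist_b indep refl, folded ws_def]
  have ws: "set ws \<subseteq> carrier_vec n" "corthogonal ws" "length ws = n"
    by (auto simp: len_b)
  have hdws: "hd ws = v"
    using gram_schmidt_hd[OF v(1), of vs, folded bv] unfolding ws_def .
  have wsc: "ws ! j \<in> carrier_vec n" if "j < n" for j
    using ws that by auto
  define s where "s j = sqrt (\<Sum>k<n. (cmod (ws ! j $ k))\<^sup>2)" for j
  define W where "W = mat n n (\<lambda>(k, j). ws ! j $ k / complex_of_real (s j))"
  have W: "W \<in> carrier_mat n n" by (simp add: W_def)
  have ip: "(\<Sum>k<n. cnj (ws ! i $ k) * (ws ! j $ k)) = (if i = j then complex_of_real ((s i)\<^sup>2) else 0)"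
    and pos: "(s i)\<^sup>2 > 0" if "i < n" "j < n" for i j
  proof -
    have e: "(\<Sum>k<n. cnj (ws ! i $ k) * (ws ! j $ k)) = ws ! j \<bullet>c ws ! i"
      if "i < n" "j < n" for i j
      using wsc[OF that(1)] by (simp add: scalar_prod_def atLeast0LessThan mult.commute)
    have s2: "(s i)\<^sup>2 = (\<Sum>k<n. (cmod (ws ! i $ k))\<^sup>2)"
      unfolding s_def by (simp add: sum_nonneg)
    have s3: "(\<Sum>k<n. cnj (ws ! i $ k) * (ws ! i $ k)) = complex_of_real ((s i)\<^sup>2)"
      unfolding s2 of_real_sum
      by (rule sum.cong) (simp_all only: complex_norm_square mult.commute)
    \<comment> \<open>Orthogonality in the sense of \<open>corthogonal\<close> includes that no
      vector has vanishing product with itself.\<close>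
    have "(s i)\<^sup>2 \<noteq> 0"
      using corthogonalD[OF ws(2), of i i] that ws(3) e[of i i] s3 by auto
    then show "(s i)\<^sup>2 > 0" by simp
    show "(\<Sum>k<n. cnj (ws ! i $ k) * (ws ! j $ k)) = (if i = j then complex_of_real ((s i)\<^sup>2) else 0)"
      using corthogonalD[OF ws(2), of j i] that ws(3) e[of i j] s3 by auto
  qed
  have "mat_adjoint W * W = 1\<^sub>m n"
  proof (rule eq_matI)
    fix i j assume "i < dim_row (1\<^sub>m n :: complex mat)" "j < dim_col (1\<^sub>m n :: complex mat)"
    then have ij: "i < n" "j < n" by auto
    have "(mat_adjoint W * W) $$ (i, j)
        = (\<Sum>k<n. cnj (ws ! i $ k) * (ws ! j $ k)) / (complex_of_real (s i) * complex_of_real (s j))"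
      unfolding index_adjoint_mult[OF W W ij] sum_divide_distrib
      by (rule sum.cong) (use ij in \<open>auto simp: W_def\<close>)
    then show "(mat_adjoint W * W) $$ (i, j) = 1\<^sub>m n $$ (i, j)"
      unfolding ip[OF ij] using ij pos[OF ij] by (auto simp: power2_eq_square)
  qed (use W in auto)
  moreover have ws0: "ws ! 0 = v" using hdws ws(3) n by (cases ws) auto
  have "col W 0 = (1 / complex_of_real (s 0)) \<cdot>\<^sub>v v"
    using n ws0 v(1) by (intro eq_vecI) (auto simp: W_def)
  ultimately show ?thesis using that W by blast
qed

lemma mat_adjoint_mult_conj:
  fixes A :: "complex mat"
  assumes A: "A \<in> carrier_mat n n" and U: "U \<in> carrier_mat n k" and V: "V \<in> carrier_mat k p"
  shows "mat_adjoint (U * V) * A * (U * V) = mat_adjoint V * (mat_adjoint U * A * U) * V"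
proof -
  have aU: "mat_adjoint U \<in> carrier_mat k n" and aV: "mat_adjoint V \<in> carrier_mat p k"
    using U V by simp_all
  have UA: "mat_adjoint U * A \<in> carrier_mat k n" using aU A by simp
  have "mat_adjoint (U * V) * A * (U * V) = mat_adjoint V * (mat_adjoint U * A) * U * V"
    unfolding mat_adjoint_mult[OF U V] assoc_mult_mat[OF aV aU A]
    by (rule assoc_mult_mat[OF mult_carrier_mat[OF aV UA] U V, symmetric])
  then show ?thesis unfolding assoc_mult_mat[OF aV UA U] .
qed

lemma hermitian_mat_conj:
  fixes A :: "complex mat"
  assumes "A \<in> carrier_mat n n" "hermitian_mat A" "W \<in> carrier_mat n k"
  shows "hermitian_mat (mat_adjoint W * A * W)"
proof -
  have aW: "mat_adjoint W \<in> carrier_mat k n" using assms(3) by simp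
  have "mat_adjoint (mat_adjoint W * A * W) = mat_adjoint W * (mat_adjoint A * W)"
    unfolding mat_adjoint_mult[OF mult_carrier_mat[OF aW assms(1)] assms(3)]
      mat_adjoint_mult[OF aW assms(1)] by simp
  then show ?thesis
    using assms assoc_mult_mat[OF aW assms(1,3)] by (simp add: hermitian_mat_def)
qed

text \<open>Deflation by induction on the list of roots: a unitary whose first column is an
  eigenvector splits off a block of size 1, and the Hermitian remainder has the remaining roots. The
  order of \<open>es\<close> dictates the order on the diagonal: sorted when applied to
  \<open>H\<close>, arbitrary for a Gram matrix.\<close>

theorem hermitian_diagonalization:
  fixes A :: "complex mat"
  assumes "A \<in> carrier_mat n n" "hermitian_mat A" "char_poly A = (\<Prod>e\<leftarrow>es. [:- e, 1:])"
  shows "\<exists>U \<in> carrier_mat n n. mat_adjoint U * U = 1\<^sub>m n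
    \<and> mat_adjoint U * A * U = mat_diag n (\<lambda>i. es ! i)"
  using assms
proof (induction es arbitrary: n A)
  case Nil
  then have "n = 0" using degree_monic_char_poly[of A n] by auto
  then show ?case using Nil by (intro bexI[of _ "1\<^sub>m n"]) (auto simp: mat_diag_def)
next
  case (Cons e es n A)
  note A = Cons.prems(1)
  have cp: "char_poly A = [:-e, 1:] * (\<Prod>e\<leftarrow>es. [:-e, 1:])" using Cons.prems by simp
  have "degree (\<Prod>e\<leftarrow>es. [:-e, 1:]) = length es"
    by (rule degree_linear_factors)
  moreover have "monic (\<Prod>e\<leftarrow>es. [:- e, 1:])" by (rule monic_prod_list) auto
  ultimately have "degree (char_poly A) = Suc (length es)"
    unfolding cp by (subst degree_mult_eq) auto
  then have n: "n = Suc (length es)" using degree_monic_char_poly[OF A] by simp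
  define k where "k = length es"
  have nk: "n = Suc k" using n k_def by simp
  have "eigenvalue A e" unfolding eigenvalue_root_char_poly[OF A] cp by simp
  then obtain v where v: "v \<in> carrier_vec n" "v \<noteq> 0\<^sub>v n" "A *\<^sub>v v = e \<cdot>\<^sub>v v"
    using A unfolding eigenvalue_def eigenvector_def by auto
  obtain W c where W: "W \<in> carrier_mat n n" "mat_adjoint W * W = 1\<^sub>m n" "col W 0 = c \<cdot>\<^sub>v v"
    using exists_unitary_first_col[OF v(1,2)] .
  note WW = unitary_adjoint[OF W(1,2)]
  define B where "B = mat_adjoint W * A * W"
  have aW: "mat_adjoint W \<in> carrier_mat n n" using W by simp
  have B: "B \<in> carrier_mat n n" using aW A W(1) by (auto simp: B_def)
  have B': "B = mat_adjoint W * (A * W)" unfolding B_def using aW A W(1) by (simp add: assoc_mult_mat[of _ n n _ n _ n])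
  have hB: "hermitian_mat B" unfolding B_def
    using hermitian_mat_conj[OF A Cons.prems(2) W(1)] .
  have "A *\<^sub>v (c \<cdot>\<^sub>v v) = c \<cdot>\<^sub>v (A *\<^sub>v v)" using A v(1) by (rule mult_mat_vec)
  then have colAW: "col (A * W) 0 = e \<cdot>\<^sub>v col W 0"
    using col_mult2[OF A W(1), of 0] n unfolding W(3) v(3)
    by (simp add: smult_smult_assoc mult.commute)
  have col0: "B $$ (i, 0) = (if i = 0 then e else 0)" if "i < n" for i
  proof -
    have "B $$ (i, 0) = row (mat_adjoint W) i \<bullet> col (A * W) 0"
      unfolding B' using that n aW A W(1) by simp
    also have "\<dots> = e * (row (mat_adjoint W) i \<bullet> col W 0)"
      unfolding colAW using aW col_carrier_vec[OF _ W(1), of 0] n that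
      by (intro scalar_prod_smult_distrib[of _ n]) auto
    also have "row (mat_adjoint W) i \<bullet> col W 0 = (mat_adjoint W * W) $$ (i, 0)"
      using that n aW W(1) by simp
    finally show ?thesis unfolding W(2) using that n by simp
  qed
  have herm: "B $$ (i, j) = cnj (B $$ (j, i))" if "i < n" "j < n" for i j
    using index_mat_adjoint[of i B j] hB B that by (simp add: hermitian_mat_def)
  \<comment> \<open>Hermitian symmetry carries the zeros of the first column over to the first row,
    so \<open>B\<close> is block diagonal and not merely block triangular.\<close>
  have row0: "B $$ (0, i) = (if i = 0 then e else 0)" if "i < n" for i
    using herm[of 0 i] herm[of 0 0] col0[OF that] col0[of 0] n that by (auto split: if_splits)
  define D where "D = mat k k (\<lambda>(i, j). B $$ (Suc i, Suc j))"
  have D: "D \<in> carrier_mat k k" by (simp add: D_def)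
  define E where "E = mat 1 1 (\<lambda>_. e)"
  have E: "E \<in> carrier_mat 1 1" by (simp add: E_def)
  have Bblk: "B = four_block_mat E (0\<^sub>m 1 k) (0\<^sub>m k 1) D"
    using B nk by (intro eq_matI) (auto simp: E_def D_def row0 col0)
  have hD: "hermitian_mat D" unfolding hermitian_mat_def
    using nk by (intro eq_matI) (auto simp: index_mat_adjoint D_def herm[symmetric])
  \<comment> \<open>Similarity equates the characteristic polynomials of \<open>A\<close> and
    \<open>B\<close>; cancelling the factor of \<open>E\<close> leaves the factorization that the
    induction hypothesis asks of \<open>D\<close>.\<close>
  have "W * B * mat_adjoint W = A"
  proof -
    have "W * B = (W * mat_adjoint W) * (A * W)"
      unfolding B' using aW A W(1) by (simp add: assoc_mult_mat[of _ n n _ n _ n])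
    also have "\<dots> = A * W" unfolding WW using A W(1) by simp
    finally have "W * B * mat_adjoint W = A * (W * mat_adjoint W)"
      using assoc_mult_mat[OF A W(1) aW] by simp
    then show ?thesis unfolding WW using A by simp
  qed
  then have "similar_mat_wit A B W (mat_adjoint W)"
    by (intro similar_mat_witI[OF WW W(2) _ A B W(1) aW]) (rule sym)
  then have "similar_mat A B" unfolding similar_mat_def by blast
  then have "[:-e, 1:] * (\<Prod>e\<leftarrow>es. [:-e, 1:]) = char_poly E * char_poly D"
    unfolding cp[symmetric] char_poly_four_block_zeros_col[OF E zero_carrier_mat D, symmetric]
      Bblk[symmetric] by (rule char_poly_similar)
  moreover have "char_poly E = [:-e, 1:]"
    by (simp add: E_def char_poly_defs det_def sign_def)
  ultimately have "char_poly D = (\<Prod>e\<leftarrow>es. [:-e, 1:])"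
    by (metis mult_cancel_left pCons_eq_0_iff zero_neq_one)
  from Cons.IH[OF D hD this] obtain V where V: "V \<in> carrier_mat k k" "mat_adjoint V * V = 1\<^sub>m k"
    "mat_adjoint V * D * V = mat_diag k (\<lambda>i. es ! i)" by auto
  define V' where "V' = four_block_mat (1\<^sub>m 1) (0\<^sub>m 1 k) (0\<^sub>m k 1) V"
  have V': "V' \<in> carrier_mat n n" unfolding V'_def nk using V(1)
    by (metis four_block_carrier_mat one_carrier_mat plus_1_eq_Suc)
  have aV': "mat_adjoint V' = four_block_mat (1\<^sub>m 1) (0\<^sub>m 1 k) (0\<^sub>m k 1) (mat_adjoint V)"
    unfolding V'_def using mat_adjoint_four_block[of "1\<^sub>m 1" 1 1 V k k] V(1) by simp
  have aV: "mat_adjoint V \<in> carrier_mat k k" using V by simp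
  have uV': "mat_adjoint V' * V' = 1\<^sub>m n"
    unfolding aV' unfolding V'_def nk
    by (subst mult_four_block_mat[of _ 1 1 _ k _ k _ _ 1 _ k])
      (use V aV in \<open>auto intro!: eq_matI\<close>)
  have "mat_adjoint V' * B = four_block_mat E (0\<^sub>m 1 k) (0\<^sub>m k 1) (mat_adjoint V * D)"
    unfolding aV' Bblk
    by (subst mult_four_block_mat[of _ 1 1 _ k _ k _ _ 1 _ k])
      (use V(1) aV E D in auto)
  then have "mat_adjoint V' * B * V' = four_block_mat E (0\<^sub>m 1 k) (0\<^sub>m k 1) (mat_adjoint V * D * V)"
    unfolding V'_def
    by (simp, subst mult_four_block_mat[of _ 1 1 _ k _ k _ _ 1 _ k])
      (use V(1) aV E D in auto)
  also have "\<dots> = mat_diag n (\<lambda>i. (e # es) ! i)"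
    unfolding V(3) unfolding nk E_def by (intro eq_matI) (auto simp: mat_diag_def nth_Cons')
  finally have dV': "mat_adjoint V' * B * V' = mat_diag n (\<lambda>i. (e # es) ! i)" .
  define U where "U = W * V'"
  have U: "U \<in> carrier_mat n n" using W V' by (simp add: U_def)
  \<comment> \<open>Unitarity is read as conjugation of the identity, so the product rule used for
    \<open>A\<close> applies again.\<close>
  have "mat_adjoint U * 1\<^sub>m n * U = mat_adjoint V' * (mat_adjoint W * 1\<^sub>m n * W) * V'"
    unfolding U_def using W(1) V' by (intro mat_adjoint_mult_conj) auto
  then have "mat_adjoint U * U = 1\<^sub>m n"
    using right_mult_one_mat[OF mat_adjoint_carrier[OF U]] right_mult_one_mat[OF aW]
      right_mult_one_mat[OF mat_adjoint_carrier[OF V']] W(2) uV' by simp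
  moreover have "mat_adjoint U * A * U = mat_adjoint V' * B * V'"
    unfolding U_def B_def using A W(1) V' by (rule mat_adjoint_mult_conj)
  ultimately show ?case using U dV' by auto
qed

section \<open>Energy in singular value coordinates\<close>

lemma mat_trace_comm:
  fixes A B :: "complex mat"
  assumes "A \<in> carrier_mat n k" "B \<in> carrier_mat k n"
  shows "mat_trace (A * B) = mat_trace (B * A)"
proof -
  have "mat_trace (A * B) = (\<Sum>i<n. \<Sum>j<k. A $$ (i, j) * B $$ (j, i))"
    using assms unfolding mat_trace_def
    by (intro sum.cong) (auto simp: index_mult_mat_sum[of _ n k _ n] simp del: index_mult_mat(1))
  also have "\<dots> = (\<Sum>j<k. \<Sum>i<n. B $$ (j, i) * A $$ (i, j))"
    by (subst sum.swap) (simp add: mult.commute)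
  also have "\<dots> = mat_trace (B * A)"
    using assms unfolding mat_trace_def
    by (intro sum.cong) (auto simp: index_mult_mat_sum[of _ k n _ k] simp del: index_mult_mat(1))
  finally show ?thesis .
qed

lemma mat_trace_unitary_conj:
  fixes V A :: "complex mat"
  assumes V: "V \<in> carrier_mat n n" "mat_adjoint V * V = 1\<^sub>m n" and A: "A \<in> carrier_mat n n"
  shows "mat_trace (V * A * mat_adjoint V) = mat_trace A"
proof -
  have aV: "mat_adjoint V \<in> carrier_mat n n" using V by simp
  have VA: "V * A \<in> carrier_mat n n" using V A by simp
  show ?thesis
    unfolding mat_trace_comm[OF VA aV] assoc_mult_mat[OF aV V(1) A, symmetric] V(2)
    using A by simp
qed

lemma unitary_conj_mult:
  fixes V A B :: "complex mat"
  assumes V: "V \<in> carrier_mat n n" "mat_adjoint V * V = 1\<^sub>m n"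
    and A: "A \<in> carrier_mat n n" and B: "B \<in> carrier_mat n n"
  shows "(V * A * mat_adjoint V) * (V * B * mat_adjoint V) = V * (A * B) * mat_adjoint V"
proof -
  have aV: "mat_adjoint V \<in> carrier_mat n n" using V by simp
  have VA: "V * A \<in> carrier_mat n n" and VB: "V * B \<in> carrier_mat n n" using V A B by simp_all
  have "(V * A * mat_adjoint V) * (V * B) = V * A * (mat_adjoint V * (V * B))"
    using VA aV VB by (rule assoc_mult_mat)
  also have "\<dots> = V * (A * B)"
    unfolding assoc_mult_mat[OF aV V(1) B, symmetric] V(2) left_mult_one_mat[OF B]
    using V(1) A B by (rule assoc_mult_mat)
  finally show ?thesis
    using assoc_mult_mat[OF mult_carrier_mat[OF VA aV] VB aV] by simp
qed

lemma index_unitary_conj_diag: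
  fixes V :: "complex mat"
  assumes "V \<in> carrier_mat n n" "i < n" "j < n"
  shows "(V * mat_diag n f * mat_adjoint V) $$ (i, j) = (\<Sum>k<n. V $$ (i, k) * f k * cnj (V $$ (j, k)))"
  unfolding mat_diag_mult_right[OF assms(1)]
  by (subst index_mult_mat_sum[of _ n n _ n]) (use assms in \<open>auto simp: index_mat_adjoint\<close>)

text \<open>Holds because the identity is its own conjugate under \<open>V\<close>. It serves with
  \<open>a = 2\<close> for the first factor of the energy and with \<open>a = 1\<close> for the
  distance of the Gram matrix from the identity.\<close>

lemma unitary_conj_diag_affine:
  fixes V :: "complex mat"
  assumes V: "V \<in> carrier_mat n n" "mat_adjoint V * V = 1\<^sub>m n"
  shows "a \<cdot>\<^sub>m 1\<^sub>m n - V * mat_diag n f * mat_adjoint V = V * mat_diag n (\<lambda>i. a - f i) * mat_adjoint V"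
proof (rule eq_matI)
  have c: "V * mat_diag n f * mat_adjoint V \<in> carrier_mat n n" for f :: "nat \<Rightarrow> complex"
    by (rule mult_carrier_mat[OF mult_carrier_mat[OF V(1)] mat_adjoint_carrier[OF V(1)]]) simp
  fix i j assume "i < dim_row (V * mat_diag n (\<lambda>i. a - f i) * mat_adjoint V)"
    "j < dim_col (V * mat_diag n (\<lambda>i. a - f i) * mat_adjoint V)"
  then have ij: "i < n" "j < n" using V(1) by auto
  have "1\<^sub>m n $$ (i, j) = (\<Sum>k<n. V $$ (i, k) * cnj (V $$ (j, k)))"
    unfolding unitary_adjoint[OF V, symmetric]
    by (subst index_mult_mat_sum[of _ n n _ n]) (use V(1) ij in \<open>auto simp: index_mat_adjoint\<close>)
  moreover have "(a \<cdot>\<^sub>m 1\<^sub>m n - V * mat_diag n f * mat_adjoint V) $$ (i, j)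
      = a * 1\<^sub>m n $$ (i, j) - (V * mat_diag n f * mat_adjoint V) $$ (i, j)"
    using ij c[of f] V(1) by (simp del: index_mult_mat(1))
  ultimately show "(a \<cdot>\<^sub>m 1\<^sub>m n - V * mat_diag n f * mat_adjoint V) $$ (i, j)
      = (V * mat_diag n (\<lambda>i. a - f i) * mat_adjoint V) $$ (i, j)"
    unfolding index_unitary_conj_diag[OF V(1) ij]
    by (simp add: sum_distrib_left sum_subtractf[symmetric] algebra_simps)
qed (use V(1) in auto)

text \<open>The trace form reduces unitary invariance of the norm to invariance of the trace under
  conjugation.\<close>

lemma frobenius_norm_trace:
  fixes A :: "complex mat"
  shows "frobenius_norm A = sqrt (Re (mat_trace (mat_adjoint A * A)))"
proof -
  have "mat_trace (mat_adjoint A * A) = (\<Sum>j<dim_col A. \<Sum>i<dim_row A. cnj (A $$ (i, j)) * A $$ (i, j))"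
    unfolding mat_trace_def
    by (intro sum.cong) (auto simp: index_adjoint_mult[of _ "dim_row A" "dim_col A" _ "dim_col A"]
        simp del: index_mult_mat(1))
  also have "Re \<dots> = (\<Sum>j<dim_col A. \<Sum>i<dim_row A. (cmod (A $$ (i, j)))\<^sup>2)"
    by (simp add: cmod_power2) (simp add: power2_eq_square)
  also have "\<dots> = (\<Sum>i<dim_row A. \<Sum>j<dim_col A. (cmod (A $$ (i, j)))\<^sup>2)"
    by (rule sum.swap)
  finally show ?thesis unfolding frobenius_norm_def by simp
qed

lemma adjoint_conj_svd:
  fixes A :: "complex mat"
  assumes A: "A \<in> carrier_mat n n" and U: "U \<in> carrier_mat n n"
    and C: "C \<in> carrier_mat n m" and V: "V \<in> carrier_mat m m"
  shows "mat_adjoint (U * C * mat_adjoint V) * A * (U * C * mat_adjoint V)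
    = V * (mat_adjoint C * (mat_adjoint U * A * U) * C) * mat_adjoint V"
  using mat_adjoint_mult_conj[OF A mult_carrier_mat[OF U C] mat_adjoint_carrier[OF V]]
    mat_adjoint_mult_conj[OF A U C] by simp

lemma gram_svd:
  fixes U :: "complex mat"
  assumes U: "U \<in> carrier_mat n n" "mat_adjoint U * U = 1\<^sub>m n"
    and C: "C \<in> carrier_mat n m" and V: "V \<in> carrier_mat m m"
  shows "mat_adjoint (U * C * mat_adjoint V) * (U * C * mat_adjoint V)
    = V * (mat_adjoint C * C) * mat_adjoint V"
proof -
  have "U * C * mat_adjoint V \<in> carrier_mat n m"
    by (rule mult_carrier_mat[OF mult_carrier_mat[OF U(1) C] mat_adjoint_carrier[OF V]])
  then show ?thesis
    using adjoint_conj_svd[OF one_carrier_mat U(1) C V] U(2)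
      right_mult_one_mat[OF mat_adjoint_carrier] U(1) C by metis
qed

lemma frobenius_norm_svd:
  fixes U :: "complex mat"
  assumes U: "U \<in> carrier_mat n n" "mat_adjoint U * U = 1\<^sub>m n"
    and C: "C \<in> carrier_mat n m"
    and V: "V \<in> carrier_mat m m" "mat_adjoint V * V = 1\<^sub>m m"
  shows "frobenius_norm (U * C * mat_adjoint V) = frobenius_norm C"
  unfolding frobenius_norm_trace gram_svd[OF U C V(1)]
  by (subst mat_trace_unitary_conj[OF V]) (use C in auto)

text \<open>Both factors under the trace are conjugated by the same \<open>V\<close>, which cancels.
  The first factor becomes diagonal, so only the diagonal entries of the second one,
  \<open>K\<close>, contribute.\<close>

lemma energy0_svd:
  fixes U H C V :: "complex mat" and l d :: "nat \<Rightarrow> real"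
  assumes H: "H \<in> carrier_mat n n"
    and U: "U \<in> carrier_mat n n" "mat_adjoint U * U = 1\<^sub>m n"
    and HU: "mat_adjoint U * H * U = mat_diag n (\<lambda>k. complex_of_real (l k))"
    and V: "V \<in> carrier_mat m m" "mat_adjoint V * V = 1\<^sub>m m"
    and C: "C \<in> carrier_mat n m"
    and CC: "mat_adjoint C * C = mat_diag m (\<lambda>i. complex_of_real (d i))"
  shows "energy0 H (U * C * mat_adjoint V)
    = (\<Sum>i<m. (2 - d i) * (\<Sum>k<n. l k * (cmod (C $$ (k, i)))\<^sup>2))"
proof -
  define X where "X = U * C * mat_adjoint V"
  define K where "K = mat_adjoint C * mat_diag n (\<lambda>k. complex_of_real (l k)) * C"
  have aC: "mat_adjoint C \<in> carrier_mat m n" using C by simp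
  have K: "K \<in> carrier_mat m m" unfolding K_def using C aC
    by (intro mult_carrier_mat[of _ m n] mult_carrier_mat[of _ m n _ n]) auto
  have X: "dim_col X = m" using V by (simp add: X_def)
  have "(2 \<cdot>\<^sub>m 1\<^sub>m (dim_col X) - mat_adjoint X * X) * (mat_adjoint X * H * X)
      = V * (mat_diag m (\<lambda>i. 2 - complex_of_real (d i)) * K) * mat_adjoint V"
    unfolding X unfolding X_def gram_svd[OF U C V(1)] adjoint_conj_svd[OF H U(1) C V(1)] HU CC
      unitary_conj_diag_affine[OF V] K_def[symmetric]
    by (rule unitary_conj_mult[OF V _ K]) simp
  then have "energy0 H X = Re (mat_trace (mat_diag m (\<lambda>i. 2 - complex_of_real (d i)) * K))"
    unfolding energy0_def using mat_trace_unitary_conj[OF V] K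
    by (metis mat_diag_dim mult_carrier_mat)
  also have "\<dots> = (\<Sum>i<m. Re ((2 - complex_of_real (d i)) * K $$ (i, i)))"
    unfolding mat_diag_mult_left[OF K] mat_trace_def by simp
  also have "\<dots> = (\<Sum>i<m. (2 - d i) * (\<Sum>k<n. l k * (cmod (C $$ (k, i)))\<^sup>2))"
  proof (rule sum.cong)
    fix i assume "i \<in> {..<m}"
    then have i: "i < m" by simp
    have "K = mat_adjoint C * mat n m (\<lambda>(k, j). complex_of_real (l k) * C $$ (k, j))"
      unfolding K_def mat_diag_mult_left[OF C, symmetric]
      by (rule assoc_mult_mat[OF aC mat_diag_dim C])
    then have "K $$ (i, i) = (\<Sum>k<n. cnj (C $$ (k, i)) * (complex_of_real (l k) * C $$ (k, i)))"
      using i index_adjoint_mult[OF C, of "mat n m (\<lambda>(k, j). complex_of_real (l k) * C $$ (k, j))" m i i]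
      by simp
    also have "\<dots> = complex_of_real (\<Sum>k<n. l k * (cmod (C $$ (k, i)))\<^sup>2)"
      unfolding of_real_sum of_real_mult complex_norm_square by (simp add: mult_ac)
    finally show "Re ((2 - complex_of_real (d i)) * K $$ (i, i))
      = (2 - d i) * (\<Sum>k<n. l k * (cmod (C $$ (k, i)))\<^sup>2)"
      by (simp del: of_real_sum of_real_mult)
  qed simp
  finally show ?thesis unfolding X_def .
qed

text \<open>\<open>V\<close> diagonalizes the Gram matrix of \<open>X\<close>, and \<open>C\<close>
  is \<open>X\<close> written in the bases \<open>U\<close> and \<open>V\<close>. Since
  \<open>U\<close> is prescribed (later an eigenbasis of \<open>H\<close>), \<open>C\<close> has
  orthogonal columns but need not be diagonal, unlike in the usual singular value
  decomposition.\<close>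

lemma exists_svd:
  fixes U X :: "complex mat"
  assumes U: "U \<in> carrier_mat n n" "mat_adjoint U * U = 1\<^sub>m n" and X: "X \<in> carrier_mat n m"
  obtains C V d where "C \<in> carrier_mat n m" "V \<in> carrier_mat m m" "mat_adjoint V * V = 1\<^sub>m m"
    "mat_adjoint C * C = mat_diag m (\<lambda>i. complex_of_real (d i))" "X = U * C * mat_adjoint V"
proof -
  have aX: "mat_adjoint X \<in> carrier_mat m n" and aU: "mat_adjoint U \<in> carrier_mat n n"
    using X U by simp_all
  have G: "mat_adjoint X * X \<in> carrier_mat m m" using aX X by (rule mult_carrier_mat)
  have "hermitian_mat (mat_adjoint X * X)"
    unfolding hermitian_mat_def mat_adjoint_mult[OF aX X] by simp
  moreover obtain es where "char_poly (mat_adjoint X * X) = (\<Prod>e\<leftarrow>es. [:- e, 1:])"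
    using char_poly_factorized[OF G] by auto
  ultimately obtain V where V: "V \<in> carrier_mat m m" "mat_adjoint V * V = 1\<^sub>m m"
    and D: "mat_adjoint V * (mat_adjoint X * X) * V = mat_diag m (\<lambda>i. es ! i)"
    using hermitian_diagonalization[OF G] by blast
  define C where "C = mat_adjoint U * X * V"
  have C: "C \<in> carrier_mat n m" unfolding C_def using aU X V by simp
  have CC: "mat_adjoint C * C = mat_diag m (\<lambda>i. es ! i)"
    using gram_svd[OF aU _ X mat_adjoint_carrier[OF V(1)]] unitary_adjoint[OF U]
    by (simp add: C_def D)
  \<comment> \<open>The roots come as complex numbers; being squared column norms of
    \<open>C\<close>, they are real.\<close>
  have "es ! i = complex_of_real (\<Sum>k<n. (cmod (C $$ (k, i)))\<^sup>2)" if "i < m" for i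
  proof -
    have "es ! i = (mat_adjoint C * C) $$ (i, i)" unfolding CC using that by (simp add: mat_diag_def)
    also have "\<dots> = complex_of_real (\<Sum>k<n. (cmod (C $$ (k, i)))\<^sup>2)"
      unfolding index_adjoint_mult[OF C C that that] of_real_sum complex_norm_square
      by (simp add: mult.commute)
    finally show ?thesis .
  qed
  then have "mat_diag m (\<lambda>i. es ! i)
      = mat_diag m (\<lambda>i. complex_of_real (\<Sum>k<n. (cmod (C $$ (k, i)))\<^sup>2))"
    by (intro eq_matI) (auto simp: mat_diag_def simp del: of_real_sum)
  then have CC': "mat_adjoint C * C
      = mat_diag m (\<lambda>i. complex_of_real (\<Sum>k<n. (cmod (C $$ (k, i)))\<^sup>2))"
    using CC by simp
  have "U * C * mat_adjoint V = X"
  proof -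
    have aUX: "mat_adjoint U * X \<in> carrier_mat n m" using aU X by simp
    have "U * C * mat_adjoint V = U * (C * mat_adjoint V)"
      by (rule assoc_mult_mat[OF U(1) C mat_adjoint_carrier[OF V(1)]])
    also have "C * mat_adjoint V = mat_adjoint U * X"
      unfolding C_def assoc_mult_mat[OF aUX V(1) mat_adjoint_carrier[OF V(1)]] unitary_adjoint[OF V]
      using aUX by (rule right_mult_one_mat)
    also have "U * (mat_adjoint U * X) = X"
      unfolding assoc_mult_mat[OF U(1) aU X, symmetric] unitary_adjoint[OF U] using X by simp
    finally show ?thesis .
  qed
  then show ?thesis using that[OF C V CC'] by simp
qed

section \<open>Matrices with orthogonal columns\<close>

lemma gram_diag_index:
  fixes C :: "complex mat"
  assumes C: "C \<in> carrier_mat n m"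
    and CC: "mat_adjoint C * C = mat_diag m (\<lambda>i. complex_of_real (d i))"
    and ij: "i < m" "j < m"
  shows "(\<Sum>k<n. cnj (C $$ (k, i)) * C $$ (k, j)) = (if i = j then complex_of_real (d i) else 0)"
  unfolding index_adjoint_mult[OF C C ij, symmetric] CC using ij by (simp add: mat_diag_def)

lemma gram_diag_norm:
  fixes C :: "complex mat"
  assumes C: "C \<in> carrier_mat n m"
    and CC: "mat_adjoint C * C = mat_diag m (\<lambda>i. complex_of_real (d i))"
    and i: "i < m"
  shows "(\<Sum>k<n. (cmod (C $$ (k, i)))\<^sup>2) = d i"
proof -
  have "complex_of_real (\<Sum>k<n. (cmod (C $$ (k, i)))\<^sup>2) = complex_of_real (d i)"
    unfolding of_real_sum complex_norm_square
    using gram_diag_index[OF C CC i i] by (simp add: mult.commute)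
  then show ?thesis using of_real_eq_iff by blast
qed

lemma frobenius_norm_gram_diag:
  fixes C :: "complex mat"
  assumes CC: "mat_adjoint C * C = mat_diag m (\<lambda>i. complex_of_real (d i))"
  shows "frobenius_norm C = sqrt (\<Sum>i<m. d i)"
  unfolding frobenius_norm_trace CC by (simp add: mat_trace_def mat_diag_def)

text \<open>Rescaling columns keeps them orthogonal. The factors \<open>1 / sqrt (d i)\<close> will
  produce the polar factor, and \<open>1 / sqrt (d i) - 1\<close> its difference from the original
  matrix.\<close>

lemma gram_diag_scale:
  fixes C :: "complex mat"
  assumes C: "C \<in> carrier_mat n m"
    and CC: "mat_adjoint C * C = mat_diag m (\<lambda>i. complex_of_real (d i))"
  shows "mat_adjoint (C * mat_diag m (\<lambda>i. complex_of_real (s i))) * (C * mat_diag m (\<lambda>i. complex_of_real (s i)))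
    = mat_diag m (\<lambda>i. complex_of_real ((s i)\<^sup>2 * d i))" (is "mat_adjoint ?E * ?E = _")
proof (rule eq_matI)
  have E: "?E \<in> carrier_mat n m" using C by (rule mult_carrier_mat) simp
  show "dim_row (mat_adjoint ?E * ?E) = dim_row (mat_diag m (\<lambda>i. complex_of_real ((s i)\<^sup>2 * d i)))"
    "dim_col (mat_adjoint ?E * ?E) = dim_col (mat_diag m (\<lambda>i. complex_of_real ((s i)\<^sup>2 * d i)))"
    by (simp_all add: mat_diag_def)
  fix i j assume "i < dim_row (mat_diag m (\<lambda>i. complex_of_real ((s i)\<^sup>2 * d i)))"
    "j < dim_col (mat_diag m (\<lambda>i. complex_of_real ((s i)\<^sup>2 * d i)))"
  then have ij: "i < m" "j < m" by (simp_all add: mat_diag_def)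
  have "(mat_adjoint ?E * ?E) $$ (i, j) = (\<Sum>k<n. cnj (?E $$ (k, i)) * ?E $$ (k, j))"
    by (rule index_adjoint_mult[OF E E ij])
  also have "\<dots> = complex_of_real (s i) * complex_of_real (s j)
      * (\<Sum>k<n. cnj (C $$ (k, i)) * C $$ (k, j))"
    unfolding mat_diag_mult_right[OF C] sum_distrib_left
    by (rule sum.cong) (use ij in auto)
  finally show "(mat_adjoint ?E * ?E) $$ (i, j)
      = mat_diag m (\<lambda>i. complex_of_real ((s i)\<^sup>2 * d i)) $$ (i, j)"
    unfolding gram_diag_index[OF C CC ij] using ij by (auto simp: mat_diag_def power2_eq_square)
qed

section \<open>Bessel and Ky Fan inequalities\<close>

text \<open>Bessel's inequality for the normalized columns of \<open>C\<close>, tested against the \<open>k\<close>-th unit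
  vector \<open>e\<close>: if \<open>v\<close> is the orthogonal projection of \<open>e\<close>, the sum \<open>S\<close> below equals both \<open>v\<^sub>k\<close> and
  the squared norm of \<open>v\<close>, whence \<open>S\<^sup>2 \<le> S\<close>.\<close>

lemma bessel_columns:
  fixes C :: "complex mat"
  assumes C: "C \<in> carrier_mat n m"
    and CC: "mat_adjoint C * C = mat_diag m (\<lambda>i. complex_of_real (d i))"
    and J: "J \<subseteq> {..<m}" "\<And>i. i \<in> J \<Longrightarrow> d i > 0" and k: "k < n"
  shows "(\<Sum>i\<in>J. (cmod (C $$ (k, i)))\<^sup>2 / d i) \<le> 1"
proof -
  define S where "S = (\<Sum>i\<in>J. (cmod (C $$ (k, i)))\<^sup>2 / d i)"
  define v where "v r = (\<Sum>i\<in>J. cnj (C $$ (k, i)) / complex_of_real (d i) * C $$ (r, i))" for r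
  have finJ: "finite J" using J(1) finite_subset by blast
  have S0: "S \<ge> 0" unfolding S_def using J(2) by (intro sum_nonneg) (simp add: less_imp_le)
  have vk: "v k = complex_of_real S"
    unfolding v_def S_def of_real_sum of_real_divide complex_norm_square
    by (rule sum.cong) auto
  have "complex_of_real (\<Sum>r<n. (cmod (v r))\<^sup>2) = (\<Sum>r<n. v r * cnj (v r))"
    unfolding of_real_sum complex_norm_square ..
  also have "\<dots> = (\<Sum>r<n. \<Sum>i\<in>J. \<Sum>j\<in>J.
      (cnj (C $$ (k, i)) / complex_of_real (d i)) * (C $$ (k, j) / complex_of_real (d j))
        * (cnj (C $$ (r, j)) * C $$ (r, i)))"
    unfolding v_def cnj_sum sum_product by (intro sum.cong) auto
  also have "\<dots> = (\<Sum>i\<in>J. \<Sum>j\<in>J. \<Sum>r<n.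
      (cnj (C $$ (k, i)) / complex_of_real (d i)) * (C $$ (k, j) / complex_of_real (d j))
        * (cnj (C $$ (r, j)) * C $$ (r, i)))"
    by (subst sum.swap, rule sum.cong[OF refl], rule sum.swap)
  also have "\<dots> = (\<Sum>i\<in>J. \<Sum>j\<in>J. if j = i then
      (cnj (C $$ (k, i)) / complex_of_real (d i)) * (C $$ (k, i) / complex_of_real (d i))
        * complex_of_real (d i) else 0)"
  proof (intro sum.cong refl)
    fix i j assume "i \<in> J" "j \<in> J"
    then have ij: "j < m" "i < m" using J(1) by auto
    show "(\<Sum>r<n. (cnj (C $$ (k, i)) / complex_of_real (d i)) * (C $$ (k, j) / complex_of_real (d j))
        * (cnj (C $$ (r, j)) * C $$ (r, i))) = (if j = i then
      (cnj (C $$ (k, i)) / complex_of_real (d i)) * (C $$ (k, i) / complex_of_real (d i))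
        * complex_of_real (d i) else 0)"
      unfolding sum_distrib_left[symmetric] gram_diag_index[OF C CC ij] by simp
  qed
  also have "\<dots> = (\<Sum>i\<in>J. C $$ (k, i) * cnj (C $$ (k, i)) / complex_of_real (d i))"
    using finJ J(2) by (intro sum.cong) (auto simp: less_imp_neq[symmetric])
  also have "\<dots> = complex_of_real S"
    unfolding S_def of_real_sum of_real_divide complex_norm_square ..
  finally have "(\<Sum>r<n. (cmod (v r))\<^sup>2) = S" using of_real_eq_iff by blast
  moreover have "(cmod (v k))\<^sup>2 \<le> (\<Sum>r<n. (cmod (v r))\<^sup>2)"
    using k by (intro member_le_sum) auto
  ultimately have "S * S \<le> 1 * S" unfolding vk using S0 by (simp add: power2_eq_square)
  then show ?thesis unfolding S_def[symmetric] using S0 by (cases "S = 0") auto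
qed

text \<open>The weights \<open>q k\<close> lie between 0 and 1 by Bessel and add up to
  \<open>card J\<close>. Once \<open>l p\<close> is subtracted from every eigenvalue, the weighted
  sum is smallest for weight 1 up to \<open>p\<close> and 0 beyond. The number of columns may differ
  from \<open>Suc p\<close>; the term with \<open>l p\<close> accounts for the difference.\<close>

lemma ky_fan_columns:
  fixes C :: "complex mat" and l :: "nat \<Rightarrow> real"
  assumes C: "C \<in> carrier_mat n m"
    and CC: "mat_adjoint C * C = mat_diag m (\<lambda>i. complex_of_real (d i))"
    and J: "J \<subseteq> {..<m}" "\<And>i. i \<in> J \<Longrightarrow> d i > 0"
    and mono: "mono_on {..<n} l" and p: "p < n"
  shows "(\<Sum>k\<le>p. l k) - (real (Suc p) - real (card J)) * l p
    \<le> (\<Sum>i\<in>J. (\<Sum>k<n. l k * (cmod (C $$ (k, i)))\<^sup>2) / d i)"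
proof -
  define q where "q k = (\<Sum>i\<in>J. (cmod (C $$ (k, i)))\<^sup>2 / d i)" for k
  have q0: "q k \<ge> 0" for k unfolding q_def using J(2) by (intro sum_nonneg) (simp add: less_imp_le)
  have q1: "q k \<le> 1" if "k < n" for k unfolding q_def using bessel_columns[OF C CC J that] .
  have sumq: "(\<Sum>k<n. q k) = real (card J)"
  proof -
    have "(\<Sum>k<n. q k) = (\<Sum>i\<in>J. (\<Sum>k<n. (cmod (C $$ (k, i)))\<^sup>2) / d i)"
      unfolding q_def sum_divide_distrib by (rule sum.swap)
    also have "\<dots> = (\<Sum>i\<in>J. 1)"
    proof (rule sum.cong)
      fix i assume "i \<in> J"
      then show "(\<Sum>k<n. (cmod (C $$ (k, i)))\<^sup>2) / d i = 1"
        using gram_diag_norm[OF C CC, of i] J(1) J(2)[of i] by auto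
    qed simp
    finally show ?thesis by simp
  qed
  have "(\<Sum>k\<le>p. l k) - real (Suc p) * l p = (\<Sum>k\<le>p. l k - l p)"
    by (simp add: sum_subtractf)
  also have "\<dots> = (\<Sum>k<n. if k \<le> p then l k - l p else 0)"
    using p by (intro sum.mono_neutral_cong_left) auto
  also have "\<dots> \<le> (\<Sum>k<n. (l k - l p) * q k)"
  proof (rule sum_mono)
    fix k assume "k \<in> {..<n}"
    then have k: "k < n" by simp
    show "(if k \<le> p then l k - l p else 0) \<le> (l k - l p) * q k"
    proof (cases "k \<le> p")
      case True
      then have "l k - l p \<le> 0" using mono_onD[OF mono, of k p] k p by simp
      then show ?thesis using True q1[OF k] mult_left_mono_neg[of "q k" 1 "l k - l p"] by simp
    next
      case False
      then have "l k - l p \<ge> 0" using mono_onD[OF mono, of p k] k p by simp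
      then show ?thesis using False q0[of k] by simp
    qed
  qed
  also have "\<dots> = (\<Sum>k<n. l k * q k) - l p * real (card J)"
    by (simp add: left_diff_distrib sum_subtractf sum_distrib_left[symmetric] sumq)
  also have "(\<Sum>k<n. l k * q k) = (\<Sum>i\<in>J. (\<Sum>k<n. l k * (cmod (C $$ (k, i)))\<^sup>2) / d i)"
    unfolding q_def sum_divide_distrib sum_distrib_left by (subst sum.swap) simp
  finally show ?thesis by (simp add: algebra_simps)
qed

section \<open>Minimizers\<close>

definition entry_norm :: "complex mat \<Rightarrow> real"
  where "entry_norm X = (\<Sum>i<dim_row X. \<Sum>j<dim_col X. cmod (X $$ (i, j)))"

lemma entry_norm_nonneg: "entry_norm X \<ge> 0"
  unfolding entry_norm_def by (intro sum_nonneg) auto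

text \<open>Cauchy-Schwarz against the constant 1 on the \<open>n * m\<close> index pairs.\<close>

lemma entry_norm_le_frobenius:
  assumes "X \<in> carrier_mat n m"
  shows "entry_norm X \<le> sqrt (real n * real m) * frobenius_norm X"
proof -
  let ?S = "{..<n} \<times> {..<m}"
  have "entry_norm X = (\<Sum>p\<in>?S. \<bar>cmod (X $$ p)\<bar> * \<bar>1\<bar>)"
    using assms by (simp add: entry_norm_def sum.cartesian_product case_prod_unfold)
  also have "\<dots> \<le> L2_set (\<lambda>p. cmod (X $$ p)) ?S * L2_set (\<lambda>_. 1) ?S"
    by (rule L2_set_mult_ineq)
  also have "L2_set (\<lambda>p. cmod (X $$ p)) ?S = frobenius_norm X"
    using assms by (simp add: L2_set_def frobenius_norm_def sum.cartesian_product case_prod_unfold)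
  finally show ?thesis by (simp add: L2_set_def mult.commute)
qed

lemma entry_norm_diff:
  assumes "X \<in> carrier_mat n m" "Y \<in> carrier_mat n m"
  shows "entry_norm Y - entry_norm X \<le> entry_norm (Y - X)"
proof -
  have "entry_norm Y - entry_norm X = (\<Sum>i<n. \<Sum>j<m. cmod (Y $$ (i, j)) - cmod (X $$ (i, j)))"
    using assms by (simp add: entry_norm_def sum_subtractf)
  also have "\<dots> \<le> (\<Sum>i<n. \<Sum>j<m. cmod ((Y - X) $$ (i, j)))"
    using assms by (intro sum_mono) (auto intro: norm_triangle_ineq2)
  finally show ?thesis using assms by (simp add: entry_norm_def)
qed

text \<open>The trial matrix consists of the first \<open>m\<close> columns of \<open>U\<close>,
  which are orthonormal eigenvectors. Its Frobenius norm is \<open>sqrt m\<close>, so Cauchy-Schwarz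
  bounds the entrywise norm by \<open>sqrt (n * m) * sqrt m\<close>.\<close>

lemma energy0_ground_state:
  fixes U H :: "complex mat" and l :: "nat \<Rightarrow> real"
  assumes H: "H \<in> carrier_mat n n"
    and U: "U \<in> carrier_mat n n" "mat_adjoint U * U = 1\<^sub>m n"
    and HU: "mat_adjoint U * H * U = mat_diag n (\<lambda>k. complex_of_real (l k))"
    and "m \<le> n"
  obtains X where "X \<in> carrier_mat n m" "energy0 H X = (\<Sum>k<m. l k)"
    "entry_norm X \<le> real m * sqrt (real n)"
proof -
  define C where "C = mat n m (\<lambda>(k, i). if k = i then 1 else 0 :: complex)"
  have C: "C \<in> carrier_mat n m" by (simp add: C_def)
  have CC: "mat_adjoint C * C = mat_diag m (\<lambda>i. complex_of_real 1)"
  proof (rule eq_matI)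
    fix i j assume "i < dim_row (mat_diag m (\<lambda>i. complex_of_real 1))"
      "j < dim_col (mat_diag m (\<lambda>i. complex_of_real 1))"
    then have ij: "i < m" "j < m" by simp_all
    have "(mat_adjoint C * C) $$ (i, j) = (\<Sum>k<n. if k = i then (if k = j then 1 else 0) else 0)"
      unfolding index_adjoint_mult[OF C C ij] by (rule sum.cong) (use ij in \<open>auto simp: C_def\<close>)
    then show "(mat_adjoint C * C) $$ (i, j) = mat_diag m (\<lambda>i. complex_of_real 1) $$ (i, j)"
      using ij assms(5) by (simp add: mat_diag_def)
  qed (simp_all add: C_def)
  \<comment> \<open>The right factor is the identity, written as an adjoint to fit
    \<open>energy0_svd\<close>.\<close>
  let ?X = "U * C * mat_adjoint (1\<^sub>m m)"
  have X: "?X \<in> carrier_mat n m"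
    by (rule mult_carrier_mat[OF mult_carrier_mat[OF U(1) C]]) simp
  have "(\<Sum>k<n. l k * (cmod (C $$ (k, i)))\<^sup>2) = l i" if "i < m" for i
  proof -
    have "(\<Sum>k<n. l k * (cmod (C $$ (k, i)))\<^sup>2) = (\<Sum>k<n. if k = i then l k else 0)"
      by (rule sum.cong) (use that in \<open>auto simp: C_def\<close>)
    then show ?thesis using that assms(5) by simp
  qed
  then have "energy0 H ?X = (\<Sum>k<m. l k)"
    by (subst energy0_svd[OF H U HU _ _ C CC]) simp_all
  moreover have "frobenius_norm ?X = sqrt (real m)"
    by (subst frobenius_norm_svd[OF U C]) (simp_all add: frobenius_norm_gram_diag[OF CC])
  then have "entry_norm ?X \<le> real m * sqrt (real n)"
    using entry_norm_le_frobenius[OF X] by (simp add: real_sqrt_mult mult.assoc) (simp add: mult.commute)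
  ultimately show ?thesis using that X by blast
qed

section \<open>Energy of a single column\<close>

lemma two_minus_mult_le_one:
  fixes x :: real
  shows "(2 - x) * x \<le> 1"
  using zero_le_power2[of "x - 1"] by (simp add: power2_eq_square algebra_simps)

text \<open>Each nonzero column other than \<open>i\<close> contributes at least its Rayleigh
  quotient, and by Ky Fan these quotients add up to at least the sum of the \<open>m - 1\<close>
  lowest eigenvalues. Indices start at 0, so \<open>l (m - 1)\<close> is the \<open>m\<close>-th
  eigenvalue.\<close>

lemma column_energy_bound:
  fixes C :: "complex mat" and l :: "nat \<Rightarrow> real"
  assumes C: "C \<in> carrier_mat n m"
    and CC: "mat_adjoint C * C = mat_diag m (\<lambda>i. complex_of_real (d i))"
    and mono: "mono_on {..<n} l" and neg: "\<And>k. k < n \<Longrightarrow> l k \<le> 0"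
    and i: "i < m" and mn: "m \<le> n"
  defines "h \<equiv> \<lambda>j. \<Sum>k<n. l k * (cmod (C $$ (k, j)))\<^sup>2"
  shows "(\<Sum>k<m. l k) + (2 - d i) * h i - l (m - 1) \<le> (\<Sum>j<m. (2 - d j) * h j)"
proof -
  have d0: "d j \<ge> 0" if "j < m" for j
    unfolding gram_diag_norm[OF C CC that, symmetric] by (simp add: sum_nonneg)
  have h0: "h j \<le> 0" for j unfolding h_def
    by (intro sum_nonpos mult_nonpos_nonneg) (auto simp: neg)
  have hz: "h j = 0" if "j < m" "d j = 0" for j
  proof -
    have "(cmod (C $$ (k, j)))\<^sup>2 = 0" if "k < n" for k
      using gram_diag_norm[OF C CC \<open>j < m\<close>] \<open>d j = 0\<close> that
        sum_nonneg_eq_0_iff[of "{..<n}" "\<lambda>k. (cmod (C $$ (k, j)))\<^sup>2"] by auto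
    then show ?thesis unfolding h_def by simp
  qed
  \<comment> \<open>Ky Fan divides by \<open>d j\<close>, so zero columns are left out; they carry
    no energy by \<open>hz\<close>.\<close>
  define J where "J = {j. j < m \<and> j \<noteq> i \<and> d j > 0}"
  have J: "J \<subseteq> {..<m}" "\<And>j. j \<in> J \<Longrightarrow> d j > 0" unfolding J_def by auto
  have finJ: "finite J" using J(1) finite_subset by blast
  have "J \<subseteq> {..<m} - {i}" unfolding J_def by auto
  from card_mono[OF _ this] i have cJ: "real (card J) \<le> real m - 1" by simp
  have m: "m > 0" using i by simp
  \<comment> \<open>Ky Fan will be used with \<open>p = m - 1\<close> although \<open>J\<close> has
    at most \<open>m - 1\<close> elements. At least one copy of the nonpositive
    \<open>l (m - 1)\<close> is then subtracted, and any further copy only raises the right-hand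
    side. The case \<open>m = 1\<close> with empty \<open>J\<close> is included.\<close>
  have "(\<Sum>k<m. l k) - l (m - 1) \<le> (\<Sum>k<m. l k) - (real m - real (card J)) * l (m - 1)"
    using mult_right_mono_neg[of 1 "real m - real (card J)" "l (m - 1)"] cJ neg[of "m - 1"] m mn by simp
  also have "\<dots> \<le> (\<Sum>j\<in>J. h j / d j)"
    using ky_fan_columns[OF C CC J mono, of "m - 1"] m mn
    by (simp add: h_def lessThan_Suc_atMost[symmetric])
  also have "\<dots> \<le> (\<Sum>j\<in>J. (2 - d j) * h j)"
  proof (rule sum_mono)
    fix j assume "j \<in> J"
    then have "d j > 0" by (rule J)
    \<comment> \<open>Multiplying \<open>(2 - d j) * d j \<le> 1\<close> by the nonpositive Rayleigh
      quotient reverses the inequality.\<close>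
    then show "h j / d j \<le> (2 - d j) * h j"
      using mult_right_mono_neg[OF two_minus_mult_le_one[of "d j"], of "h j / d j"] h0[of j]
      by (simp add: divide_nonpos_pos)
  qed
  also have "\<dots> = (\<Sum>j\<in>{..<m} - {i}. (2 - d j) * h j)"
  proof (rule sum.mono_neutral_left)
    show "\<forall>j\<in>{..<m} - {i} - J. (2 - d j) * h j = 0"
      using hz d0 unfolding J_def by (auto simp: less_le)
  qed (auto simp: J_def)
  finally show ?thesis using i by (subst (2) sum.remove[of _ i]) auto
qed

section \<open>Distance of the Gram matrix from the identity\<close>

lemma frobenius_norm_mat_diag:
  "frobenius_norm (mat_diag m (\<lambda>i. complex_of_real (f i))) = sqrt (\<Sum>i<m. (f i)\<^sup>2)"
proof -
  have "(\<Sum>i<m. \<Sum>j<m. (cmod (mat_diag m (\<lambda>i. complex_of_real (f i)) $$ (i, j)))\<^sup>2)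
      = (\<Sum>i<m. \<Sum>j<m. if j = i then (f i)\<^sup>2 else 0)"
    by (intro sum.cong) (auto simp: mat_diag_def)
  then show ?thesis unfolding frobenius_norm_def by (simp add: mat_diag_def)
qed

lemma frobenius_norm_minus_commute:
  assumes "A \<in> carrier_mat n m" "B \<in> carrier_mat n m"
  shows "frobenius_norm (A - B) = frobenius_norm (B - A)"
proof -
  have "cmod ((A - B) $$ (i, j)) = cmod ((B - A) $$ (i, j))" if "i < n" "j < m" for i j
    using assms that by (simp add: norm_minus_commute)
  then show ?thesis using assms unfolding frobenius_norm_def by simp
qed

text \<open>The gain from passing to the polar factor is quadratic in the distance while the cost in
  the penalty is linear, so dividing by the distance bounds it. The margin \<open>g\<close> is such
  that all column Rayleigh quotients of a minimizer are at most \<open>- g\<close>.\<close>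

theorem gram_distance_bound:
  fixes H X :: "complex mat" and l :: "nat \<Rightarrow> real"
  assumes H: "H \<in> carrier_mat n n"
    and U: "U \<in> carrier_mat n n" "mat_adjoint U * U = 1\<^sub>m n"
    and HU: "mat_adjoint U * H * U = mat_diag n (\<lambda>k. complex_of_real (l k))"
    and mono: "mono_on {..<n} l" and neg: "\<And>k. k < n \<Longrightarrow> l k \<le> 0"
    and m: "0 < m" "m \<le> n" and \<mu>: "\<mu> \<ge> 0"
    and g: "g > 0" "l (m - 1) + \<mu> * (real m * sqrt (real n)) \<le> - g"
    and X: "X \<in> minimizers n m H \<mu>"
  shows "g * frobenius_norm (mat_adjoint X * X - 1\<^sub>m m) \<le> \<mu> * sqrt (real n * real m)"
proof -
  have Xc: "X \<in> carrier_mat n m"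
    and Xmin: "\<And>Y. Y \<in> carrier_mat n m \<Longrightarrow> energy H \<mu> X \<le> energy H \<mu> Y"
    using X by (auto simp: minimizers_def)
  have energy: "energy H \<mu> Y = energy0 H Y + \<mu> * entry_norm Y" for Y
    by (simp add: energy_def entry_norm_def)
  obtain C V d where C: "C \<in> carrier_mat n m" and V: "V \<in> carrier_mat m m" "mat_adjoint V * V = 1\<^sub>m m"
    and CC: "mat_adjoint C * C = mat_diag m (\<lambda>i. complex_of_real (d i))"
    and XC: "X = U * C * mat_adjoint V"
    using exists_svd[OF U Xc] .
  define h where "h j = (\<Sum>k<n. l k * (cmod (C $$ (k, j)))\<^sup>2)" for j
  have h0: "h j \<le> 0" for j unfolding h_def
    by (intro sum_nonpos mult_nonpos_nonneg) (auto simp: neg)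
  have d0: "d j \<ge> 0" if "j < m" for j
    unfolding gram_diag_norm[OF C CC that, symmetric] by (simp add: sum_nonneg)
  have EX: "energy0 H X = (\<Sum>i<m. (2 - d i) * h i)"
    unfolding XC h_def by (rule energy0_svd[OF H U HU V C CC])
  obtain X0 where X0: "X0 \<in> carrier_mat n m" "energy0 H X0 = (\<Sum>k<m. l k)"
    "entry_norm X0 \<le> real m * sqrt (real n)"
    using energy0_ground_state[OF H U HU m(2)] .
  have "energy0 H X \<le> energy H \<mu> X"
    unfolding energy using \<mu> entry_norm_nonneg[of X] by simp
  also have "\<dots> \<le> (\<Sum>k<m. l k) + \<mu> * (real m * sqrt (real n))"
    using Xmin[OF X0(1)] mult_left_mono[OF X0(3) \<mu>] unfolding energy X0(2) by simp
  finally have EX_le: "energy0 H X \<le> (\<Sum>k<m. l k) + \<mu> * (real m * sqrt (real n))" .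
  \<comment> \<open>The energy exceeds the sum of the \<open>m\<close> lowest eigenvalues by at most
    the penalty bound of the trial matrix \<open>X0\<close>. Subtracting the least possible share of
    the other columns leaves this bound for column \<open>i\<close>.\<close>
  have col: "(2 - d i) * h i \<le> - g" if "i < m" for i
    using column_energy_bound[OF C CC mono neg that m(2)] EX_le g(2) unfolding EX h_def by linarith
  \<comment> \<open>A zero column would have \<open>h i = 0\<close>, against the strictly negative
    bound \<open>col\<close>.\<close>
  have dpos: "d i > 0" if i: "i < m" for i
  proof -
    have "(cmod (C $$ (k, i)))\<^sup>2 = 0" if "d i = 0" "k < n" for k
      using gram_diag_norm[OF C CC i] that
        sum_nonneg_eq_0_iff[of "{..<n}" "\<lambda>k. (cmod (C $$ (k, i)))\<^sup>2"] by auto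
    then have "h i = 0" if "d i = 0" unfolding h_def using that by simp
    then show ?thesis using col[OF i] g(1) d0[OF i] by (cases "d i = 0") auto
  qed
  have ray: "h i / d i \<le> - g" if i: "i < m" for i
  proof -
    have "h i / d i \<le> (2 - d i) * h i"
      using mult_right_mono_neg[OF two_minus_mult_le_one[of "d i"], of "h i / d i"] h0[of i] dpos[OF i]
      by (simp add: divide_nonpos_pos)
    then show ?thesis using col[OF i] by linarith
  qed
  \<comment> \<open>These factors normalize the columns of \<open>C\<close>, which makes
    \<open>Y\<close> the polar factor of \<open>X\<close>.\<close>
  define s where "s i = 1 / sqrt (d i)" for i
  define E where "E = C * mat_diag m (\<lambda>i. complex_of_real (s i))"
  define Y where "Y = U * E * mat_adjoint V"
  have E: "E \<in> carrier_mat n m" unfolding E_def using C by (rule mult_carrier_mat) simp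
  have aV: "mat_adjoint V \<in> carrier_mat m m" using V by simp
  have Y: "Y \<in> carrier_mat n m" unfolding Y_def
    by (rule mult_carrier_mat[OF mult_carrier_mat[OF U(1) E] aV])
  have sd: "(s i)\<^sup>2 * d i = 1" if "i < m" for i
    unfolding s_def using dpos[OF that] by (simp add: power_divide)
  have EE: "mat_adjoint E * E = mat_diag m (\<lambda>i. complex_of_real ((s i)\<^sup>2 * d i))"
    unfolding E_def by (rule gram_diag_scale[OF C CC])
  have "energy0 H Y = (\<Sum>i<m. (2 - (s i)\<^sup>2 * d i) * (\<Sum>k<n. l k * (cmod (E $$ (k, i)))\<^sup>2))"
    unfolding Y_def by (rule energy0_svd[OF H U HU V E EE])
  also have "\<dots> = (\<Sum>i<m. h i / d i)"
  proof (rule sum.cong)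
    fix i assume "i \<in> {..<m}"
    then have i: "i < m" by simp
    have "(\<Sum>k<n. l k * (cmod (E $$ (k, i)))\<^sup>2) = (\<Sum>k<n. (s i)\<^sup>2 * (l k * (cmod (C $$ (k, i)))\<^sup>2))"
      unfolding E_def mat_diag_mult_right[OF C]
      by (rule sum.cong) (use i in \<open>auto simp: norm_mult power_mult_distrib\<close>)
    also have "\<dots> = h i / d i"
      unfolding h_def sum_distrib_left[symmetric] using dpos[OF i] by (simp add: s_def power_divide)
    finally show "(2 - (s i)\<^sup>2 * d i) * (\<Sum>k<n. l k * (cmod (E $$ (k, i)))\<^sup>2) = h i / d i"
      unfolding sd[OF i] by simp
  qed simp
  finally have EY: "energy0 H Y = (\<Sum>i<m. h i / d i)" .
  define F where "F = sqrt (\<Sum>i<m. (d i - 1)\<^sup>2)"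
  have F: "frobenius_norm (mat_adjoint X * X - 1\<^sub>m m) = F"
  proof -
    have "mat_adjoint X * X = V * mat_diag m (\<lambda>i. complex_of_real (d i)) * mat_adjoint V"
      unfolding XC gram_svd[OF U C V(1)] CC ..
    then have "1 \<cdot>\<^sub>m 1\<^sub>m m - mat_adjoint X * X
        = V * mat_diag m (\<lambda>i. complex_of_real (1 - d i)) * mat_adjoint V"
      by (simp only: unitary_conj_diag_affine[OF V] of_real_diff of_real_1)
    then have "frobenius_norm (1 \<cdot>\<^sub>m 1\<^sub>m m - mat_adjoint X * X) = sqrt (\<Sum>i<m. (1 - d i)\<^sup>2)"
      by (simp only: frobenius_norm_svd[OF V mat_diag_dim V] frobenius_norm_mat_diag)
    also have "\<dots> = F" unfolding F_def by (simp only: power2_commute)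
    also have "1 \<cdot>\<^sub>m 1\<^sub>m m = (1\<^sub>m m :: complex mat)" by (rule eq_matI) auto
    also have "frobenius_norm (1\<^sub>m m - mat_adjoint X * X) = frobenius_norm (mat_adjoint X * X - 1\<^sub>m m)"
      using Xc by (intro frobenius_norm_minus_commute[of _ m m] mult_carrier_mat[of _ m n]) auto
    finally show ?thesis .
  qed
  have YX: "frobenius_norm (Y - X) \<le> F"
  proof -
    have UC: "U * C \<in> carrier_mat n m" and UE: "U * E \<in> carrier_mat n m" using U C E by simp_all
    have "Y - X = U * (E - C) * mat_adjoint V"
      unfolding Y_def XC mult_minus_distrib_mat[OF U(1) E C] minus_mult_distrib_mat[OF UE UC aV] ..
    also have "E - C = C * mat_diag m (\<lambda>i. complex_of_real (s i - 1))"
      unfolding E_def mat_diag_mult_right[OF C] using C by (intro eq_matI) (auto simp: algebra_simps)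
    finally have "frobenius_norm (Y - X) = frobenius_norm (C * mat_diag m (\<lambda>i. complex_of_real (s i - 1)))"
      using frobenius_norm_svd[OF U mult_carrier_mat[OF C mat_diag_dim] V] by simp
    also have "\<dots> = sqrt (\<Sum>i<m. (s i - 1)\<^sup>2 * d i)"
      by (rule frobenius_norm_gram_diag[OF gram_diag_scale[OF C CC]])
    also have "\<dots> \<le> F" unfolding F_def
    proof (intro real_sqrt_le_mono sum_mono)
      fix i assume "i \<in> {..<m}"
      then have "d i > 0" using dpos by simp
      define r where "r = sqrt (d i)"
      have r: "r > 0" "d i = r\<^sup>2" using \<open>d i > 0\<close> by (simp_all add: r_def)
      have "(s i - 1)\<^sup>2 * d i = ((s i - 1) * r)\<^sup>2" by (simp add: r(2) power_mult_distrib)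
      also have "(s i - 1) * r = 1 - r" using r(1) by (simp add: s_def r_def[symmetric] field_simps)
      \<comment> \<open>Here \<open>r\<close> is a singular value: \<open>1 - d i\<close> factors as
        \<open>(1 - r) * (1 + r)\<close>, and the second factor is at least 1.\<close>
      also have "(1 - r)\<^sup>2 \<le> (1 - r)\<^sup>2 * (1 + r)\<^sup>2"
        using mult_left_mono[of 1 "(1 + r)\<^sup>2" "(1 - r)\<^sup>2"] r(1) by (simp add: one_le_power)
      also have "\<dots> = (d i - 1)\<^sup>2" unfolding r(2) by (simp add: power2_eq_square algebra_simps)
      finally show "(s i - 1)\<^sup>2 * d i \<le> (d i - 1)\<^sup>2" .
    qed
    finally show ?thesis .
  qed
  have "g * F\<^sup>2 = (\<Sum>i<m. g * (d i - 1)\<^sup>2)"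
    unfolding F_def by (simp add: sum_nonneg sum_distrib_left)
  also have "\<dots> \<le> (\<Sum>i<m. (2 - d i) * h i - h i / d i)"
  proof (rule sum_mono)
    fix i assume "i \<in> {..<m}"
    then have i: "i < m" by simp
    \<comment> \<open>This is \<open>(2 - d) * d - 1 = - (d - 1)\<^sup>2\<close> times the Rayleigh
      quotient; it makes the gain quadratic.\<close>
    have "(2 - d i) * h i - h i / d i = - (h i / d i) * (d i - 1)\<^sup>2"
      using dpos[OF i] by (simp add: field_simps power2_eq_square)
    then show "g * (d i - 1)\<^sup>2 \<le> (2 - d i) * h i - h i / d i"
      using ray[OF i] mult_right_mono[of g "- (h i / d i)" "(d i - 1)\<^sup>2"] by simp
  qed
  also have "\<dots> = energy0 H X - energy0 H Y" unfolding EX EY by (simp add: sum_subtractf)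
  also have "\<dots> \<le> \<mu> * (entry_norm Y - entry_norm X)"
    using Xmin[OF Y] unfolding energy by (simp add: algebra_simps)
  also have "\<dots> \<le> \<mu> * (sqrt (real n * real m) * F)"
  proof (rule mult_left_mono[OF _ \<mu>])
    have "entry_norm Y - entry_norm X \<le> sqrt (real n * real m) * frobenius_norm (Y - X)"
      using entry_norm_diff[OF Xc Y] entry_norm_le_frobenius[OF minus_carrier_mat[OF Xc], of Y] by linarith
    also have "\<dots> \<le> sqrt (real n * real m) * F"
      using YX by (intro mult_left_mono) auto
    finally show "entry_norm Y - entry_norm X \<le> sqrt (real n * real m) * F" .
  qed
  \<comment> \<open>For \<open>F > 0\<close> the common factor cancels; for \<open>F = 0\<close> the
    claim is that the right-hand side is nonnegative.\<close>
  finally have "F * (g * F) \<le> F * (\<mu> * sqrt (real n * real m))"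
    by (simp add: power2_eq_square mult_ac)
  moreover have "F \<ge> 0" unfolding F_def by (simp add: sum_nonneg)
  ultimately show ?thesis unfolding F using \<mu> by (cases "F = 0") auto
qed

section \<open>Zero-based eigenvalues and the choice of the threshold\<close>

theorem corollary2:
  fixes N m :: nat and H :: "complex mat" and lam :: "nat \<Rightarrow> real" and \<alpha> :: real
  assumes "0 < m" and "m < N"
    and "H \<in> carrier_mat N N" and "hermitian_mat H" and "negative_definite_mat N H"
    and "ordered_eigenvalues N H lam" and "lam N < 0"
    and "lam m < lam (m + 1)"
    and "0 < \<alpha>" and "\<alpha> < 1"
  shows "\<exists>\<mu>\<^sub>0 > 0. \<forall>\<mu>. 0 < \<mu> \<and> \<mu> < \<mu>\<^sub>0 \<longrightarrow>
    (\<forall>X \<in> minimizers N m H \<mu>.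
      frobenius_norm (mat_adjoint X * X - 1\<^sub>m m)
        \<le> 2 * \<mu> * real m * sqrt (real N) / (\<alpha>\<^sup>2 * (lam (m + 1) - lam m)))"
proof -
  define l where "l k = lam (Suc k)" for k
  define gap where "gap = lam (m + 1) - lam m"
  define K where "K = real m * sqrt (real N)"
  have cp: "char_poly H = (\<Prod>k = 1..N. [: - complex_of_real (lam k), 1 :])"
    and mono_lam: "mono_on {1..N} lam"
    using assms(6) by (auto simp: ordered_eigenvalues_def)
  have mono: "mono_on {..<N} l"
    unfolding l_def by (intro mono_onI mono_onD[OF mono_lam]) auto
  have neg: "l k \<le> 0" if "k < N" for k
    using mono_onD[OF mono_lam, of "Suc k" N] that assms(7) by (simp add: l_def)
  \<comment> \<open>Listing the roots in increasing order puts the sorted eigenvalues on the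
    diagonal.\<close>
  define es where "es = map (\<lambda>k. complex_of_real (l k)) [0..<N]"
  have "(\<Prod>e\<leftarrow>es. [:- e, 1:]) = (\<Prod>k<N. [: - complex_of_real (l k), 1 :])"
    unfolding es_def by (simp add: comp_def prod.distinct_set_conv_list[symmetric] atLeast0LessThan)
  also have "\<dots> = char_poly H"
    unfolding cp l_def by (simp add: prod.atLeast1_atMost_eq)
  finally obtain U where U: "U \<in> carrier_mat N N" "mat_adjoint U * U = 1\<^sub>m N"
    and "mat_adjoint U * H * U = mat_diag N (\<lambda>i. es ! i)"
    using hermitian_diagonalization[OF assms(3,4), of es] by auto
  moreover have "mat_diag N (\<lambda>i. es ! i) = mat_diag N (\<lambda>k. complex_of_real (l k))"
    by (rule eq_matI) (auto simp: mat_diag_def es_def)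
  ultimately have HU: "mat_adjoint U * H * U = mat_diag N (\<lambda>k. complex_of_real (l k))" by simp
  have gap: "gap > 0" using assms(8) by (simp add: gap_def)
  have K: "K > 0" using assms(1,2) by (simp add: K_def)
  have "lam (m + 1) \<le> 0" using neg[OF assms(2)] by (simp add: l_def)
  \<comment> \<open>Since the eigenvalue above the gap is at most 0, the one below is at most
    \<open>- gap\<close>.\<close>
  then have lgap: "l (m - 1) \<le> - gap" using assms(1) by (simp add: l_def gap_def)
  show ?thesis
  \<comment> \<open>Below this threshold \<open>\<mu> * K\<close> is less than half the gap, so
    \<open>l (m - 1) + \<mu> * K\<close> stays below \<open>- gap / 2\<close> and the margin
    \<open>g = gap / 2\<close> is admissible.\<close>
  proof (intro exI[of _ "gap / (2 * K)"] conjI allI impI ballI)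
    show "gap / (2 * K) > 0" using gap K by simp
    fix \<mu> X assume \<mu>: "0 < \<mu> \<and> \<mu> < gap / (2 * K)" and X: "X \<in> minimizers N m H \<mu>"
    let ?F = "frobenius_norm (mat_adjoint X * X - 1\<^sub>m m)"
    have "\<mu> * K < gap / 2" using \<mu> K by (simp add: field_simps)
    then have "gap / 2 * ?F \<le> \<mu> * sqrt (real N * real m)"
      using \<mu> gap lgap assms(1,2)
      by (intro gram_distance_bound[OF assms(3) U HU mono neg _ _ _ _ _ X]) (auto simp: K_def)
    also have "\<dots> \<le> \<mu> * K"
    proof (rule mult_left_mono)
      \<comment> \<open>Because \<open>m\<close> is at least 1, the factor \<open>sqrt m\<close> may
        be relaxed to \<open>m\<close>.\<close>
      have "sqrt (real m) \<le> real m" using assms(1) by (intro real_le_lsqrt) (auto simp: power2_eq_square)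
      then show "sqrt (real N * real m) \<le> K"
        unfolding K_def real_sqrt_mult by (subst mult.commute) (rule mult_right_mono, auto)
    qed (use \<mu> in simp)
    finally have "?F \<le> 2 * \<mu> * K / gap" using gap by (simp add: field_simps)
    also have "\<dots> \<le> 2 * \<mu> * K / (\<alpha>\<^sup>2 * gap)"
    proof (rule divide_left_mono)
      have "\<alpha>\<^sup>2 \<le> 1" using assms(9,10) by (simp add: power_le_one)
      then show "\<alpha>\<^sup>2 * gap \<le> gap" using gap by simp
    qed (use \<mu> K gap assms(9) in auto)
    finally show "?F \<le> 2 * \<mu> * real m * sqrt (real N) / (\<alpha>\<^sup>2 * (lam (m + 1) - lam m))"
      by (simp add: K_def gap_def mult.assoc)
  qed
qed

end
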